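(* Let $K$ be a field of characteristic $0$ and let $\Lambda\subset K$ be any finite set of distinct non-zero elements. For all positive integers $r_0,r_1,r_2$, the divisor in $\mathbb{A}^3$ defined by $$F_\Lambda=(x^{r_0}+y^{r_1})\prod_{\alpha\in\Lambda}(x^{r_0}+y^{r_1}+\alpha z^{r_2})\in K[x,y,z]$$ is free.
   Context: For a reduced polynomial $f\in R=K[x,y,z]$, $\mathrm{Der}(f)=\{\delta\in\mathrm{Der}_K(R):\delta(f)\in Rf\}$. The divisor in $\mathbb{A}^3$ defined by $f$ is free if $\mathrm{Der}(f)$ is a free $R$-module. *)

theory Defs
  imports
    "HOL-Computational_Algebra.Polynomial"
    "HOL-Computational_Algebra.Squarefree"
    "HOL-Library.Function_Algebras"
begin

text \<open>The ring \<open>K[x,y,z]\<close> is represented as the iterated polynomial ring \<open>K[x][y][z]\<close>;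
  the outermost variable is \<open>z\<close>.\<close>

type_synonym 'a poly3 = "'a poly poly poly"

definition Const :: "'a::comm_semiring_1 \<Rightarrow> 'a poly3"
  where "Const c = [:[:[:c:]:]:]"

definition X :: "'a::comm_semiring_1 poly3"
  where "X = [:[:[:0, 1:]:]:]"

definition Y :: "'a::comm_semiring_1 poly3"
  where "Y = [:[:0, 1:]:]"

definition Z :: "'a::comm_semiring_1 poly3"
  where "Z = [:0, 1:]"

definition derivations :: "('a::field poly3 \<Rightarrow> 'a poly3) set"
  where "derivations =
    {\<delta>. (\<forall>p q. \<delta> (p + q) = \<delta> p + \<delta> q) \<and>
         (\<forall>c p. \<delta> (Const c * p) = Const c * \<delta> p) \<and>
         (\<forall>p q. \<delta> (p * q) = p * \<delta> q + q * \<delta> p)}"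

definition Der :: "'a::field poly3 \<Rightarrow> ('a poly3 \<Rightarrow> 'a poly3) set"
  where "Der f = {\<delta> \<in> derivations. f dvd \<delta> f}"

text \<open>The ambient module is that of all functions \<open>R \<Rightarrow> R\<close> with pointwise operations, where
  \<open>R = K[x,y,z]\<close>; derivations and \<open>Der f\<close> are submodules of it.\<close>

definition rscale :: "'a::field poly3 \<Rightarrow> ('a poly3 \<Rightarrow> 'a poly3) \<Rightarrow> 'a poly3 \<Rightarrow> 'a poly3"
  where "rscale r \<delta> = (\<lambda>p. r * \<delta> p)"

global_interpretation rfun: module rscale
  by unfold_locales (auto simp: rscale_def fun_eq_iff algebra_simps)

lemma subspace_derivations: "rfun.subspace derivations"
  by (auto simp: rfun.subspace_def derivations_def rscale_def algebra_simps)

lemma subspace_Der: "rfun.subspace (Der f)"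
  using subspace_derivations
  by (auto simp: rfun.subspace_def Der_def rscale_def)

definition free_submodule :: "('a::field poly3 \<Rightarrow> 'a poly3) set \<Rightarrow> bool"
  where "free_submodule M \<longleftrightarrow> (\<exists>B. rfun.independent B \<and> rfun.span B = M)"

text \<open>Freeness is a notion for divisors given by a reduced equation, so that \<open>f\<close> is reduced
  is part of the definition.\<close>

definition free_divisor :: "'a::field poly3 \<Rightarrow> bool"
  where "free_divisor f \<longleftrightarrow> squarefree f \<and> free_submodule (Der f)"

end

theory Submission imports Defs begin

text \<open>Put \<open>u = x\<^bsup>r0\<^esup> + y\<^bsup>r1\<^esup>\<close>, \<open>q\<^sub>\<alpha> = u + \<alpha> z\<^bsup>r2\<^esup>\<close> and \<open>P = \<Prod>q\<^sub>\<alpha>\<close>, so that the divisor is \<open>F = u P\<close>.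
  The logarithmic derivations have as a basis the weighted Euler field, which multiplies every
  \<open>q\<^sub>\<alpha>\<close> by 1, the Hamiltonian field \<open>u\<^sub>y \<partial>\<^sub>x - u\<^sub>x \<partial>\<^sub>y\<close>, which kills every \<open>q\<^sub>\<alpha>\<close>, and \<open>P \<partial>\<^sub>z\<close>.
  Given \<open>\<delta>\<close> with \<open>F | \<delta> F\<close>, every factor of \<open>F\<close> divides its own image under \<open>\<delta>\<close>. Subtracting a
  multiple of the Euler field makes \<open>\<delta> u\<close> vanish; since powers of \<open>x\<close> and \<open>y\<close> are coprime,
  subtracting a multiple of the Hamiltonian field then leaves \<open>c \<partial>\<^sub>z\<close>, and every \<open>q\<^sub>\<alpha>\<close> divides \<open>c\<close>.
  All cancellations use only that \<open>z\<close> is prime and divides no \<open>q\<^sub>\<alpha>\<close>, as \<open>q\<^sub>\<alpha> - q\<^sub>\<beta>\<close> is a constant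
  times a power of \<open>z\<close>. If \<open>d\<^sup>2\<close> divides \<open>F\<close>, then \<open>d\<close> divides \<open>F\<close>, \<open>F\<^sub>x\<close> and \<open>F\<^sub>y\<close>, hence \<open>u\<^sub>x\<close> and
  \<open>u\<^sub>y\<close>, so \<open>d\<close> is a unit.\<close>

section \<open>Products in commutative rings\<close>

text \<open>Non-zero-divisors modulo \<open>d\<close> are closed under products. Throughout, this
  cancellation property plays the part of coprimality.\<close>

lemma dvd_prod_mult_cancel:
  assumes "\<And>i t. i \<in> S \<Longrightarrow> d dvd f i * t \<Longrightarrow> d dvd t" "d dvd (\<Prod>i\<in>S. f i) * t"
  shows "d dvd t"
  using assms
proof (induction S arbitrary: t rule: infinite_finite_induct)
  case (insert i S)
  then have "d dvd f i * ((\<Prod>i\<in>S. f i) * t)"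
    by (simp add: mult.assoc)
  then have *: "d dvd (\<Prod>i\<in>S. f i) * t"
    by (rule insert.prems(1)[OF insertI1])
  show ?case
  proof (rule insert.IH[OF _ *])
    show "d dvd s" if "j \<in> S" "d dvd f j * s" for j s
      using that by (intro insert.prems(1)[of j s]) simp_all
  qed
next
  case empty
  from empty.prems(2) show ?case
    by simp
next
  case (infinite S)
  from infinite.prems(2) infinite.hyps show ?case
    by simp
qed

lemma dvd_prod_diff_prod:
  fixes f g :: "'b \<Rightarrow> 'a::comm_ring_1"
  assumes "\<And>i. i \<in> S \<Longrightarrow> m dvd f i - g i"
  shows "m dvd (\<Prod>i\<in>S. f i) - (\<Prod>i\<in>S. g i)"
  using assms
proof (induction S rule: infinite_finite_induct)
  case (insert c S)
  have "(\<Prod>i\<in>insert c S. f i) - (\<Prod>i\<in>insert c S. g i)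
      = f c * ((\<Prod>i\<in>S. f i) - (\<Prod>i\<in>S. g i)) + (f c - g c) * (\<Prod>i\<in>S. g i)"
    using insert.hyps by (simp add: algebra_simps)
  then show ?case
    using insert by simp
qed simp_all

text \<open>Recursion shared by the Leibniz rule for products and, with all \<open>c i\<close> equal
  to 1, by the coprimality induction in \<open>dvd_if_dvd_cofactor_sum\<close>.\<close>

lemma sum_prod_cofactors_insert:
  fixes q c :: "'b \<Rightarrow> 'a::comm_semiring_1"
  assumes "finite S" "b \<notin> S"
  shows "(\<Sum>i\<in>insert b S. c i * (\<Prod>j\<in>insert b S - {i}. q j))
    = c b * (\<Prod>i\<in>S. q i) + q b * (\<Sum>i\<in>S. c i * (\<Prod>j\<in>S - {i}. q j))"
proof -
  have "(\<Prod>j\<in>insert b S - {i}. q j) = q b * (\<Prod>j\<in>S - {i}. q j)" if "i \<in> S" for i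
  proof -
    have "insert b S - {i} = insert b (S - {i})"
      using that assms by auto
    then show ?thesis
      using assms by simp
  qed
  then have "(\<Sum>i\<in>S. c i * (\<Prod>j\<in>insert b S - {i}. q j))
      = q b * (\<Sum>i\<in>S. c i * (\<Prod>j\<in>S - {i}. q j))"
    by (simp add: sum_distrib_left mult.left_commute)
  then show ?thesis
    using assms by simp
qed

section \<open>Derivations of the polynomial ring\<close>

lemma Const_mult: "Const (a * b) = Const a * Const b"
  by (simp add: Const_def mult.commute)

lemma Const_add: "Const (a + b) = Const a + Const b"
  by (simp add: Const_def)

lemma Const_diff: "Const (a - b :: 'a::comm_ring_1) = Const a - Const b"
  by (simp add: Const_def)

lemma Const_0 [simp]: "Const 0 = 0"
  by (simp add: Const_def)

lemma Const_1 [simp]: "Const 1 = 1"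
  by (simp add: Const_def one_pCons)

lemma of_nat_eq_Const: "of_nat n = Const (of_nat n)"
  by (induction n) (simp_all add: Const_add)

lemma dvd_Const_mult_iff:
  fixes c :: "'a::field"
  assumes "c \<noteq> 0"
  shows "d dvd Const c * t \<longleftrightarrow> d dvd t"
proof
  assume "d dvd Const c * t"
  then have "d dvd Const (inverse c) * (Const c * t)"
    by (rule dvd_mult)
  also have "\<dots> = t"
    using assms by (simp flip: mult.assoc Const_mult)
  finally show "d dvd t" .
qed simp

lemma derivations_add: "\<delta> \<in> derivations \<Longrightarrow> \<delta> (p + q) = \<delta> p + \<delta> q"
  and derivations_Const_mult: "\<delta> \<in> derivations \<Longrightarrow> \<delta> (Const c * p) = Const c * \<delta> p"
  and derivations_mult: "\<delta> \<in> derivations \<Longrightarrow> \<delta> (p * q) = p * \<delta> q + q * \<delta> p"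
  by (auto simp: derivations_def)

lemma derivations_0: "\<delta> \<in> derivations \<Longrightarrow> \<delta> 0 = 0"
  using derivations_Const_mult[of \<delta> 0 0] by simp

lemma derivations_1: "\<delta> \<in> derivations \<Longrightarrow> \<delta> 1 = 0"
  by (metis add_cancel_right_right derivations_mult mult_1_left)

lemma derivations_Const: "\<delta> \<in> derivations \<Longrightarrow> \<delta> (Const c) = 0"
  using derivations_Const_mult[of \<delta> c 1] by (simp add: derivations_1)

lemma derivations_power:
  assumes "\<delta> \<in> derivations"
  shows "\<delta> (p ^ n) = of_nat n * p ^ (n - 1) * \<delta> p"
proof (induction n)
  case (Suc n)
  then show ?case
    by (cases n) (simp_all add: derivations_mult[OF assms] derivations_1[OF assms] algebra_simps)
qed (simp add: derivations_1[OF assms])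

lemma derivations_prod:
  assumes "\<delta> \<in> derivations" "finite S"
  shows "\<delta> (\<Prod>i\<in>S. f i) = (\<Sum>i\<in>S. \<delta> (f i) * (\<Prod>j\<in>S - {i}. f j))"
  using assms(2)
proof (induction S rule: finite_induct)
  case (insert k S)
  then show ?case
    using sum_prod_cofactors_insert[OF insert.hyps, of "\<lambda>i. \<delta> (f i)" f]
    by (simp add: derivations_mult[OF assms(1)] algebra_simps)
qed (simp add: derivations_1[OF assms(1)])

text \<open>A derivation is determined by its values on algebra generators. The three inductions
  follow the nesting of the polynomial rings, from K[x] out to K[x][y][z].\<close>

lemma derivations_eqI:
  assumes d: "\<delta> \<in> derivations" "\<epsilon> \<in> derivations"
    and "\<delta> X = \<epsilon> X" "\<delta> Y = \<epsilon> Y" "\<delta> Z = \<epsilon> Z"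
  shows "\<delta> = \<epsilon>"
proof
  have x: "\<delta> [:[:p:]:] = \<epsilon> [:[:p:]:]" for p
  proof (induction p)
    case (pCons a p)
    have "[:[:pCons a p:]:] = Const a + X * [:[:p:]:]"
      by (simp add: Const_def X_def)
    then show ?case
      using pCons.IH
      by (simp only: assms(3) derivations_add[OF d(1)] derivations_add[OF d(2)] derivations_mult[OF d(1)]
          derivations_mult[OF d(2)] derivations_Const[OF d(1)] derivations_Const[OF d(2)])
  qed (simp add: derivations_0 d)
  have y: "\<delta> [:p:] = \<epsilon> [:p:]" for p
  proof (induction p)
    case (pCons a p)
    have "[:pCons a p:] = [:[:a:]:] + Y * [:p:]"
      by (simp add: Y_def)
    then show ?case
      using pCons.IH
      by (simp only: assms(4) derivations_add[OF d(1)] derivations_add[OF d(2)] derivations_mult[OF d(1)]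
          derivations_mult[OF d(2)] x)
  qed (simp add: derivations_0 d)
  show "\<delta> p = \<epsilon> p" for p
  proof (induction p)
    case (pCons a p)
    have "pCons a p = [:a:] + Z * p"
      by (simp add: Z_def)
    then show ?case
      using pCons.IH
      by (simp only: assms(5) derivations_add[OF d(1)] derivations_add[OF d(2)] derivations_mult[OF d(1)]
          derivations_mult[OF d(2)] y)
  qed (simp add: derivations_0 d)
qed

lemma Der_mult:
  assumes "\<delta> \<in> Der f" "\<delta> \<in> Der g"
  shows "\<delta> \<in> Der (f * g)"
  using assms by (auto simp: Der_def derivations_mult mult.commute[of f g] intro!: dvd_add mult_dvd_mono)

lemma Der_prod:
  assumes "\<delta> \<in> derivations" "\<And>i. i \<in> S \<Longrightarrow> \<delta> \<in> Der (f i)"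
  shows "\<delta> \<in> Der (\<Prod>i\<in>S. f i)"
  using assms(2)
proof (induction S rule: infinite_finite_induct)
  case (insert i S)
  then show ?case
    by (simp add: Der_mult)
qed (simp_all add: Der_def assms(1))

text \<open>By the Leibniz rule \<open>f\<close> divides \<open>g * \<delta> f\<close>, and the
  second assumption cancels \<open>g\<close>.\<close>

lemma Der_factor:
  assumes "\<delta> \<in> Der (f * g)" "\<And>t. f dvd g * t \<Longrightarrow> f dvd t"
  shows "\<delta> \<in> Der f"
proof -
  have \<delta>: "\<delta> \<in> derivations" and "f * g dvd \<delta> (f * g)"
    using assms(1) by (simp_all add: Der_def)
  then have "f dvd f * \<delta> g + g * \<delta> f"
    using derivations_mult[OF \<delta>] dvd_mult_left by metis
  then have "f dvd g * \<delta> f"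
    by (simp add: dvd_add_right_iff)
  then have "f dvd \<delta> f"
    by (rule assms(2))
  with \<delta> show ?thesis
    by (simp add: Der_def)
qed

text \<open>A derivation of the coefficient ring, applied coefficientwise, is again a derivation.
  This lifts \<open>pderiv\<close> from the inner variables; reflecting the index of the convolution
  matches the second sum.\<close>

lemma map_poly_leibniz:
  fixes D :: "'a::comm_ring_1 \<Rightarrow> 'a"
  assumes D_add: "\<And>a b. D (a + b) = D a + D b"
    and D_mult: "\<And>a b. D (a * b) = a * D b + b * D a"
  shows "map_poly D (p * q) = p * map_poly D q + q * map_poly D p"
proof (rule poly_eqI)
  fix n
  have D0: "D 0 = 0"
    using D_add[of 0 0] by simp
  have D_sum: "D (sum f A) = (\<Sum>i\<in>A. D (f i))" for f :: "nat \<Rightarrow> 'a" and A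
    by (induction A rule: infinite_finite_induct) (simp_all add: D0 D_add)
  have "coeff (map_poly D (p * q)) n
      = (\<Sum>i\<le>n. coeff p i * D (coeff q (n - i))) + (\<Sum>i\<le>n. coeff q (n - i) * D (coeff p i))"
    by (simp add: coeff_map_poly D0 coeff_mult D_sum D_mult sum.distrib)
  also have "(\<Sum>i\<le>n. coeff q (n - i) * D (coeff p i)) = (\<Sum>i\<le>n. coeff q i * D (coeff p (n - i)))"
    by (rule sum.reindex_bij_witness[of _ "\<lambda>i. n - i" "\<lambda>i. n - i"]) auto
  finally show "coeff (map_poly D (p * q)) n = coeff (p * map_poly D q + q * map_poly D p) n"
    by (simp add: coeff_map_poly D0 coeff_mult)
qed

lemma map_poly_additive:
  fixes D :: "'a::comm_ring_1 \<Rightarrow> 'a"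
  assumes "\<And>a b. D (a + b) = D a + D b"
  shows "map_poly D (p + q) = map_poly D p + map_poly D q"
proof -
  have "D 0 = 0"
    using assms[of 0 0] by simp
  then show ?thesis
    by (intro poly_eqI) (simp add: coeff_map_poly assms)
qed

section \<open>Partial derivatives and vector fields in coordinates\<close>

definition partial_x :: "'a::field poly3 \<Rightarrow> 'a poly3"
  where "partial_x = map_poly (map_poly pderiv)"

definition partial_y :: "'a::field poly3 \<Rightarrow> 'a poly3"
  where "partial_y = map_poly pderiv"

definition partial_z :: "'a::field poly3 \<Rightarrow> 'a poly3"
  where "partial_z = pderiv"

lemma derivationsI:
  assumes "\<And>p q. \<delta> (p + q) = \<delta> p + \<delta> q" "\<And>p q. \<delta> (p * q) = p * \<delta> q + q * \<delta> p"
    and "\<And>c. \<delta> (Const c) = 0"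
  shows "\<delta> \<in> derivations"
  using assms by (simp add: derivations_def)

lemma partial_x_derivation: "partial_x \<in> derivations"
  unfolding partial_x_def
  by (intro derivationsI map_poly_additive map_poly_leibniz)
    (simp_all add: pderiv_add pderiv_mult Const_def map_poly_pCons pderiv_pCons)

lemma partial_y_derivation: "partial_y \<in> derivations"
  unfolding partial_y_def
  by (intro derivationsI map_poly_additive map_poly_leibniz)
    (simp_all add: pderiv_add pderiv_mult Const_def map_poly_pCons pderiv_pCons)

lemma partial_z_derivation: "partial_z \<in> derivations"
  unfolding partial_z_def
  by (intro derivationsI) (simp_all add: pderiv_add pderiv_mult Const_def pderiv_pCons)

lemmas partial_derivations = partial_x_derivation partial_y_derivation partial_z_derivation

lemma partial_simps [simp]:
  "partial_x X = 1" "partial_x Y = 0" "partial_x Z = 0"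
  "partial_y X = 0" "partial_y Y = 1" "partial_y Z = 0"
  "partial_z X = 0" "partial_z Y = 0" "partial_z Z = 1"
  by (simp_all add: partial_x_def partial_y_def partial_z_def X_def Y_def Z_def
      map_poly_pCons pderiv_pCons one_pCons)

definition vector_field :: "'a::field poly3 \<Rightarrow> 'a poly3 \<Rightarrow> 'a poly3 \<Rightarrow> 'a poly3 \<Rightarrow> 'a poly3"
  where "vector_field a b c = rscale a partial_x + rscale b partial_y + rscale c partial_z"

lemma vector_field_derivation: "vector_field a b c \<in> derivations"
  unfolding vector_field_def
  by (intro rfun.subspace_add rfun.subspace_scale subspace_derivations partial_derivations)

lemma vector_field_simps [simp]:
  "vector_field a b c X = a" "vector_field a b c Y = b" "vector_field a b c Z = c"
  by (simp_all add: vector_field_def rscale_def)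

lemma derivation_eq_vector_field:
  assumes "\<delta> \<in> derivations"
  shows "\<delta> = vector_field (\<delta> X) (\<delta> Y) (\<delta> Z)"
  by (intro derivations_eqI assms vector_field_derivation) simp_all

section \<open>Divisibility\<close>

text \<open>The first assumption says that z does not divide \<open>d\<close>. If
  \<open>Z * t = d * s\<close>, setting z = 0 shows that z divides \<open>s\<close>, and one factor
  z cancels on both sides.\<close>

lemma dvd_Z_mult_cancel:
  fixes d :: "'a::field poly3"
  assumes "coeff d 0 \<noteq> 0" "d dvd Z * t"
  shows "d dvd t"
proof -
  obtain s where s: "Z * t = d * s"
    using assms(2) by (auto elim: dvdE)
  then have "coeff d 0 * coeff s 0 = 0"
    by (metis Z_def coeff_mult_0 coeff_pCons_0 mult_zero_left)
  with assms(1) obtain s' where "s = Z * s'"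
    by (cases s) (auto simp: Z_def)
  with s have "Z * t = Z * (d * s')"
    by (simp add: algebra_simps)
  then have "t = d * s'"
    by (simp add: Z_def)
  then show ?thesis
    by simp
qed

lemma dvd_Z_power_mult_cancel:
  fixes d :: "'a::field poly3"
  assumes "coeff d 0 \<noteq> 0" "d dvd Z ^ n * t"
  shows "d dvd t"
  using assms(2) by (induction n) (auto simp: mult.assoc intro: dvd_Z_mult_cancel[OF assms(1)])

section \<open>Coprimality of powers of x and y\<close>

lemma X_power_eq: "X ^ n = [:[:[:0, 1:] ^ n:]:]"
  by (induction n) (simp_all add: X_def one_pCons)

lemma Y_power_eq: "Y ^ n = [:[:0, 1:] ^ n:]"
  by (induction n) (simp_all add: Y_def one_pCons)

text \<open>Divisibility by a polynomial in x alone is tested on each coefficient in y and z, and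
  multiplying by \<open>Y\<close> only shifts these coefficients.\<close>

lemma X_power_dvd_Y_power_mult:
  fixes t :: "'a::field poly3"
  assumes "X ^ i dvd Y ^ j * t"
  shows "X ^ i dvd t"
proof -
  have step: "X ^ i dvd s" if "X ^ i dvd Y * s" for s :: "'a poly3"
    unfolding X_power_eq const_poly_dvd_iff
  proof (intro allI)
    fix n m
    have "[:0, 1:] ^ i dvd coeff (coeff (Y * s) n) (Suc m)"
      using that by (simp add: X_power_eq const_poly_dvd_iff)
    then show "[:0, 1:] ^ i dvd coeff (coeff s n) m"
      by (simp add: Y_def)
  qed
  show ?thesis
    using assms by (induction j) (auto simp: mult.assoc intro: step)
qed

text \<open>A divisor of a power of x has degree 0 in z and in y. Lying in K[x], it divides every
  coefficient of the power of y, among them the leading coefficient 1.\<close>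

lemma unit_if_dvd_X_power_Y_power:
  fixes d :: "'a::field poly3"
  assumes "d dvd X ^ i" "d dvd Y ^ j"
  shows "d dvd 1"
proof -
  have "X ^ i \<noteq> (0 :: 'a poly3)"
    by (simp add: X_def)
  then have "degree d \<le> degree (X ^ i :: 'a poly3)"
    using assms(1) by (rule dvd_imp_degree_le[rotated])
  then obtain d1 where d1: "d = [:d1:]"
    by (auto simp: X_power_eq elim: degree_eq_zeroE)
  have "d1 dvd [:[:0, 1:] ^ i:]"
    using assms(1) by (simp add: d1 X_power_eq)
  then have "degree d1 \<le> degree [:[:0, 1:] ^ i :: 'a poly:]"
    by (rule dvd_imp_degree_le) simp
  then obtain d2 where d2: "d1 = [:d2:]"
    by (auto elim: degree_eq_zeroE)
  have "d1 dvd [:0, 1:] ^ j"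
    using assms(2) by (simp add: d1 Y_power_eq)
  then have "d2 dvd coeff ([:0, 1:] ^ j) j"
    by (simp add: d2 const_poly_dvd_iff)
  then have "d2 dvd 1"
    by (simp flip: monom_eq_1_iff add: coeff_linear_power)
  then show ?thesis
    by (simp add: d1 d2 one_pCons)
qed

text \<open>Modulo \<open>d\<close> this is the statement that a product of pairwise coprime polynomials is coprime
  to its derivative. In the induction, a new factor \<open>q\<close> and the product \<open>P\<close> of the old ones are
  comaximal up to a factor that can be cancelled modulo \<open>d\<close>, hence so are \<open>q\<^sup>2\<close> and \<open>P\<^sup>2\<close>.\<close>

lemma dvd_if_dvd_cofactor_sum:
  fixes q :: "'b \<Rightarrow> 'a::comm_ring_1"
  assumes "finite S"
    and "\<And>i j t. i \<in> S \<Longrightarrow> j \<in> S \<Longrightarrow> i \<noteq> j \<Longrightarrow> d dvd (q i - q j) * t \<Longrightarrow> d dvd t"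
    and "d dvd k * (\<Prod>i\<in>S. q i)" "d dvd k * (\<Sum>i\<in>S. \<Prod>j\<in>S - {i}. q j)"
  shows "d dvd k"
  using assms
proof (induction S arbitrary: k rule: finite_induct)
  case (insert b S)
  define P where "P = (\<Prod>i\<in>S. q i)"
  define D where "D = (\<Sum>i\<in>S. \<Prod>j\<in>S - {i}. q j)"
  define c where "c = (\<Prod>i\<in>S. q i - q b)"
  have "(\<Sum>i\<in>insert b S. \<Prod>j\<in>insert b S - {i}. q j) = P + q b * D"
    using sum_prod_cofactors_insert[OF insert.hyps, of "\<lambda>_. 1" q] by (simp add: P_def D_def)
  then have kD: "d dvd k * (P + q b * D)"
    using insert.prems(3) by simp
  have kP: "d dvd k * (q b * P)"
    using insert.prems(2) insert.hyps by (simp add: P_def)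
  \<comment> \<open>Multiplying \<open>P + q b * D\<close> by \<open>q b\<close> isolates
    \<open>q b ^ 2 * D\<close> modulo \<open>q b * P\<close>; multiplying it by \<open>P\<close>
    below isolates \<open>P ^ 2\<close> in the same way. The induction hypothesis is applied to
    \<open>k * q b ^ 2\<close> in place of \<open>k\<close>.\<close>
  have "k * q b ^ 2 * D = k * (P + q b * D) * q b - k * (q b * P)"
    by (simp add: power2_eq_square algebra_simps)
  also have "d dvd \<dots>"
    by (intro dvd_diff kP dvd_mult2[OF kD])
  finally have kqD: "d dvd k * q b ^ 2 * D" .
  have kqP: "d dvd k * q b ^ 2 * P"
    using dvd_mult[OF kP, of "q b"] by (simp add: power2_eq_square algebra_simps)
  have kq: "d dvd k * q b ^ 2"
  proof (rule insert.IH[OF _ kqP[unfolded P_def] kqD[unfolded D_def]])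
    show "d dvd t" if "i \<in> S" "j \<in> S" "i \<noteq> j" "d dvd (q i - q j) * t" for i j t
      using that by (intro insert.prems(1)[of i j t]) simp_all
  qed
  have "k * P ^ 2 = k * (P + q b * D) * P - k * (q b * P) * D"
    by (simp add: power2_eq_square algebra_simps)
  also have "d dvd \<dots>"
    by (intro dvd_diff dvd_mult2[OF kD] dvd_mult2[OF kP])
  finally have kPP: "d dvd k * P ^ 2" .
  have "q b dvd P - c"
    unfolding P_def c_def by (rule dvd_prod_diff_prod) simp
  then obtain t where "P - c = q b * t"
    by (auto elim: dvdE)
  then have c: "c = P - q b * t"
    by (simp add: algebra_simps)
  \<comment> \<open>Each cubic monomial in \<open>p\<close> and \<open>r\<close> contains one of
    them squared, so the cube of \<open>c = P - q b * t\<close> lies in the ideal of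
    \<open>P ^ 2\<close> and \<open>q b ^ 2\<close>. The three factors \<open>c\<close> are then
    cancelled one by one.\<close>
  have "(p - r) ^ 3 * k = k * p ^ 2 * (p - 3 * r) + k * r ^ 2 * (3 * p - r)" for p r :: 'a
    by (simp add: power2_eq_square power3_eq_cube algebra_simps)
  then have "c ^ 3 * k = k * P ^ 2 * (P - 3 * (q b * t)) + k * q b ^ 2 * (t ^ 2 * (3 * P - q b * t))"
    by (simp add: c power_mult_distrib mult.assoc)
  also have "d dvd \<dots>"
    by (intro dvd_add dvd_mult2[OF kq] dvd_mult2[OF kPP])
  finally have *: "d dvd c * (c * (c * k))"
    by (simp add: power3_eq_cube mult.assoc)
  have **: "d dvd s" if "d dvd c * s" for s
  proof (rule dvd_prod_mult_cancel)
    show "d dvd (\<Prod>i\<in>S. q i - q b) * s"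
      using that by (simp add: c_def)
    show "d dvd t" if "i \<in> S" "d dvd (q i - q b) * t" for i t
      using that insert.hyps(2) by (intro insert.prems(1)[of i b t]) auto
  qed
  show ?case
    by (rule **[OF **[OF **[OF *]]])
qed simp

section \<open>The arrangement of quasi-homogeneous surfaces\<close>

locale pencil =
  fixes \<Lambda> :: "'k::field_char_0 set" and r0 r1 r2 :: nat
  assumes finite: "finite \<Lambda>" and nonzero: "0 \<notin> \<Lambda>"
    and pos: "r0 > 0" "r1 > 0" "r2 > 0"
begin

definition u :: "'k poly3"
  where "u = X ^ r0 + Y ^ r1"

definition q :: "'k \<Rightarrow> 'k poly3"
  where "q \<alpha> = u + Const \<alpha> * Z ^ r2"

definition P :: "'k poly3"
  where "P = (\<Prod>\<alpha>\<in>\<Lambda>. q \<alpha>)"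

text \<open>Since \<open>q 0 = u\<close>, the index 0 makes the extra factor \<open>u\<close> a
  member of the same pencil, so that all factors are treated alike.\<close>

definition F :: "'k poly3"
  where "F = (\<Prod>\<alpha>\<in>insert 0 \<Lambda>. q \<alpha>)"

lemma q_0: "q 0 = u"
  by (simp add: q_def)

lemma F_eq: "F = u * P"
  using finite nonzero by (simp add: F_def P_def q_0)

lemma u_eq: "u = [:[:[:0, 1:] ^ r0:] + [:0, 1:] ^ r1:]"
  by (simp add: u_def X_power_eq Y_power_eq)

text \<open>As \<open>r2 > 0\<close>, setting z = 0 turns every \<open>q \<alpha>\<close> into
  \<open>u\<close>, in which y to the power \<open>r1\<close> has coefficient 1 because
  \<open>r1 > 0\<close>. So z divides no \<open>q \<alpha>\<close>.\<close>

lemma coeff_q_0: "coeff (q \<alpha>) 0 \<noteq> 0"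
proof -
  have "coeff (coeff (q \<alpha>) 0) r1 = 1"
    using pos by (simp add: q_def u_eq Z_def coeff_mult_0 power_0_left coeff_linear_power
        coeff_0_power coeff_pCons split: nat.split)
  then show ?thesis
    by auto
qed

lemma q_neq_0: "q \<alpha> \<noteq> 0"
  using coeff_q_0[of \<alpha>] by auto

lemma u_neq_0: "u \<noteq> 0"
  using q_neq_0[of 0] by (simp add: q_0)

lemma P_neq_0: "P \<noteq> 0"
  using finite by (simp add: P_def q_neq_0)

section \<open>Coprimality of the members of the pencil\<close>

lemma dvd_q_diff_cancel:
  assumes "coeff d 0 \<noteq> 0" "\<alpha> \<noteq> \<beta>" "d dvd (q \<alpha> - q \<beta>) * t"
  shows "d dvd t"
proof -
  have "q \<alpha> - q \<beta> = Const (\<alpha> - \<beta>) * Z ^ r2"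
    by (simp add: q_def Const_diff left_diff_distrib)
  then have "d dvd Const (\<alpha> - \<beta>) * (Z ^ r2 * t)"
    using assms(3) by (simp add: mult.assoc)
  then have "d dvd Z ^ r2 * t"
    using assms(2) by (simp add: dvd_Const_mult_iff)
  then show ?thesis
    by (rule dvd_Z_power_mult_cancel[OF assms(1)])
qed

lemma q_dvd_q_mult_cancel:
  assumes "\<alpha> \<noteq> \<beta>" "q \<alpha> dvd q \<beta> * t"
  shows "q \<alpha> dvd t"
proof -
  have "q \<alpha> dvd (q \<alpha> - q \<beta>) * t"
    using assms(2) by (simp add: left_diff_distrib)
  then show ?thesis
    by (rule dvd_q_diff_cancel[OF coeff_q_0 assms(1)])
qed

lemma prod_q_dvd:
  assumes "finite S" "\<And>\<alpha>. \<alpha> \<in> S \<Longrightarrow> q \<alpha> dvd t"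
  shows "(\<Prod>\<alpha>\<in>S. q \<alpha>) dvd t"
  using assms
proof (induction S arbitrary: t rule: finite_induct)
  case (insert \<beta> S)
  obtain s where s: "t = q \<beta> * s"
    using insert.prems[of \<beta>] by (auto elim: dvdE)
  have "q \<alpha> dvd s" if "\<alpha> \<in> S" for \<alpha>
  proof (rule q_dvd_q_mult_cancel)
    show "\<alpha> \<noteq> \<beta>"
      using that insert.hyps by auto
    show "q \<alpha> dvd q \<beta> * s"
      using that insert.prems[of \<alpha>] by (simp flip: s)
  qed
  then have "(\<Prod>\<alpha>\<in>S. q \<alpha>) dvd s"
    by (rule insert.IH)
  then show ?case
    using insert.hyps by (simp add: s mult_dvd_mono)
qed simp

lemma Der_F_imp_Der_q:
  assumes "\<delta> \<in> Der F" "\<alpha> \<in> insert 0 \<Lambda>"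
  shows "\<delta> \<in> Der (q \<alpha>)"
proof (rule Der_factor[where g = "\<Prod>\<beta>\<in>insert 0 \<Lambda> - {\<alpha>}. q \<beta>"])
  have "F = q \<alpha> * (\<Prod>\<beta>\<in>insert 0 \<Lambda> - {\<alpha>}. q \<beta>)"
    unfolding F_def using finite assms(2) by (intro prod.remove) simp_all
  then show "\<delta> \<in> Der (q \<alpha> * (\<Prod>\<beta>\<in>insert 0 \<Lambda> - {\<alpha>}. q \<beta>))"
    using assms(1) by (simp only:)
  show "q \<alpha> dvd t" if "q \<alpha> dvd (\<Prod>\<beta>\<in>insert 0 \<Lambda> - {\<alpha>}. q \<beta>) * t" for t
  proof (rule dvd_prod_mult_cancel[OF _ that])
    show "q \<alpha> dvd s" if "\<beta> \<in> insert 0 \<Lambda> - {\<alpha>}" "q \<alpha> dvd q \<beta> * s" for \<beta> s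
      using that by (auto intro: q_dvd_q_mult_cancel[OF _ that(2)])
  qed
qed

lemma derivation_u:
  assumes "\<delta> \<in> derivations"
  shows "\<delta> u = Const (of_nat r0) * X ^ (r0 - 1) * \<delta> X + Const (of_nat r1) * Y ^ (r1 - 1) * \<delta> Y"
  by (simp add: u_def derivations_add[OF assms] derivations_power[OF assms] of_nat_eq_Const)

lemma derivation_q:
  assumes "\<delta> \<in> derivations"
  shows "\<delta> (q \<alpha>) = \<delta> u + Const \<alpha> * (Const (of_nat r2) * Z ^ (r2 - 1) * \<delta> Z)"
  by (simp add: q_def derivations_add[OF assms] derivations_Const_mult[OF assms]
      derivations_power[OF assms] of_nat_eq_Const)

section \<open>Reducedness of the divisor\<close>

lemma squarefree_F: "squarefree F"
proof (rule squarefreeI)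
  fix d assume "d ^ 2 dvd F"
  then obtain e where "F = d ^ 2 * e"
    by (rule dvdE)
  then have e: "F = d * (d * e)"
    by (simp add: power2_eq_square mult.assoc)
  then have dF: "d dvd F"
    by simp
  have d\<delta>: "d dvd \<delta> F" if "\<delta> \<in> derivations" for \<delta>
    using that by (simp add: e derivations_mult distrib_left dvd_mult2)
  have "coeff F 0 = (\<Prod>\<alpha>\<in>insert 0 \<Lambda>. coeff (q \<alpha>) 0)"
    unfolding F_def poly_0_coeff_0[symmetric] by (rule poly_prod)
  then have "coeff F 0 \<noteq> 0"
    using finite by (auto simp: coeff_q_0)
  then have d0: "coeff d 0 \<noteq> 0"
    by (auto simp: e coeff_mult_0)
  \<comment> \<open>A derivation killing \<open>Z\<close> takes the same value
    \<open>\<delta> u\<close> on every \<open>q \<alpha>\<close>, so \<open>\<delta> F\<close> is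
    \<open>\<delta> u\<close> times the sum of cofactors, and \<open>dvd_if_dvd_cofactor_sum\<close>
    applies with \<open>k = \<delta> u\<close>.\<close>
  have *: "d dvd \<delta> u" if "\<delta> \<in> derivations" "\<delta> Z = 0" for \<delta>
  proof (rule dvd_if_dvd_cofactor_sum)
    show "d dvd \<delta> u * (\<Prod>\<alpha>\<in>insert 0 \<Lambda>. q \<alpha>)"
      using dF by (simp add: F_def)
    have "\<delta> F = \<delta> u * (\<Sum>\<alpha>\<in>insert 0 \<Lambda>. \<Prod>\<beta>\<in>insert 0 \<Lambda> - {\<alpha>}. q \<beta>)"
      unfolding F_def using finite that
      by (simp add: derivations_prod derivation_q sum_distrib_left del: insert_Diff_single)
    then show "d dvd \<delta> u * (\<Sum>\<alpha>\<in>insert 0 \<Lambda>. \<Prod>\<beta>\<in>insert 0 \<Lambda> - {\<alpha>}. q \<beta>)"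
      using d\<delta>[OF that(1)] by simp
    show "d dvd t" if "\<alpha> \<noteq> \<beta>" "d dvd (q \<alpha> - q \<beta>) * t" for \<alpha> \<beta> t
      using d0 that by (rule dvd_q_diff_cancel)
  qed (use finite in simp)
  show "d dvd 1"
  proof (rule unit_if_dvd_X_power_Y_power)
    show "d dvd X ^ (r0 - 1)"
      using *[OF partial_x_derivation] pos
      by (simp add: derivation_u[OF partial_x_derivation] dvd_Const_mult_iff)
    show "d dvd Y ^ (r1 - 1)"
      using *[OF partial_y_derivation] pos
      by (simp add: derivation_u[OF partial_y_derivation] dvd_Const_mult_iff)
  qed
qed

section \<open>The three basis fields\<close>

definition euler :: "'k poly3 \<Rightarrow> 'k poly3"
  where "euler = vector_field (Const (1 / of_nat r0) * X) (Const (1 / of_nat r1) * Y)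
    (Const (1 / of_nat r2) * Z)"

definition hamiltonian :: "'k poly3 \<Rightarrow> 'k poly3"
  where "hamiltonian = vector_field (Const (of_nat r1) * Y ^ (r1 - 1))
    (- (Const (of_nat r0) * X ^ (r0 - 1))) 0"

definition vertical :: "'k poly3 \<Rightarrow> 'k poly3"
  where "vertical = vector_field 0 0 P"

lemma basis_derivations:
  "euler \<in> derivations" "hamiltonian \<in> derivations" "vertical \<in> derivations"
  by (simp_all add: euler_def hamiltonian_def vertical_def vector_field_derivation)

lemma basis_simps [simp]:
  "euler X = Const (1 / of_nat r0) * X" "euler Y = Const (1 / of_nat r1) * Y"
  "euler Z = Const (1 / of_nat r2) * Z"
  "hamiltonian X = Const (of_nat r1) * Y ^ (r1 - 1)"
  "hamiltonian Y = - (Const (of_nat r0) * X ^ (r0 - 1))" "hamiltonian Z = 0"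
  "vertical X = 0" "vertical Y = 0" "vertical Z = P"
  by (simp_all add: euler_def hamiltonian_def vertical_def)

text \<open>Euler's identity for one power: the weight 1/n of a variable gives its n-th power weight
  1, which is how the coefficients of \<open>euler\<close> are chosen.\<close>

lemma Const_power_Euler:
  assumes "n > 0"
  shows "Const (of_nat n) * p ^ (n - 1) * (Const (1 / of_nat n) * p) = (p ^ n :: 'k poly3)"
proof -
  have "Const (of_nat n) * p ^ (n - 1) * (Const (1 / of_nat n) * p)
      = Const (of_nat n * (1 / of_nat n)) * (p ^ (n - 1) * p)"
    by (simp only: Const_mult mult.assoc mult.left_commute)
  also have "\<dots> = p ^ n"
    using assms by (simp add: power_minus_mult del: One_nat_def)
  finally show ?thesis .
qed

lemma basis_u [simp]: "euler u = u" "hamiltonian u = 0" "vertical u = 0"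
proof -
  show "euler u = u"
    unfolding derivation_u[OF basis_derivations(1)] using pos
    by (simp add: Const_power_Euler u_def del: One_nat_def)
qed (simp_all add: derivation_u basis_derivations)

lemma basis_q: "euler (q \<alpha>) = q \<alpha>" "hamiltonian (q \<alpha>) = 0"
proof -
  show "euler (q \<alpha>) = q \<alpha>"
    unfolding derivation_q[OF basis_derivations(1)] using pos
    by (simp add: Const_power_Euler q_def del: One_nat_def)
qed (simp add: derivation_q basis_derivations)

lemma P_dvd_vertical: "P dvd vertical p"
  by (simp add: vertical_def vector_field_def rscale_def)

lemma basis_Der: "euler \<in> Der F" "hamiltonian \<in> Der F" "vertical \<in> Der F"
proof -
  show "euler \<in> Der F" "hamiltonian \<in> Der F"
    unfolding F_def by (intro Der_prod basis_derivations; simp add: Der_def basis_derivations basis_q)+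
  show "vertical \<in> Der F"
    unfolding F_eq
    by (intro Der_mult; simp add: Der_def basis_derivations P_dvd_vertical)
qed

section \<open>The basis property\<close>

lemma independent_basis: "rfun.independent {euler, hamiltonian, vertical}"
proof -
  \<comment> \<open>Distinctness ensures that the sum over the set has three summands. Evaluating it
    at \<open>u\<close>, \<open>X\<close> and \<open>Z\<close> in turn gives a triangular
    system.\<close>
  have distinct: "euler \<noteq> hamiltonian" "euler \<noteq> vertical" "hamiltonian \<noteq> vertical"
    using u_neq_0 P_neq_0 basis_u basis_simps by metis+
  have "a euler = 0 \<and> a hamiltonian = 0 \<and> a vertical = 0"
    if "(\<Sum>\<delta>\<in>{euler, hamiltonian, vertical}. rscale (a \<delta>) \<delta>) = 0" for a
  proof -
    have *: "a euler * euler p + a hamiltonian * hamiltonian p + a vertical * vertical p = 0" for p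
      using fun_cong[OF that, of p] distinct by (simp add: rscale_def add.assoc)
    have e: "a euler = 0"
      using *[of u] u_neq_0 by simp
    moreover have "a hamiltonian = 0"
      using *[of X] pos e by (auto simp: Const_def Y_def)
    moreover have "a vertical = 0"
      using *[of Z] e P_neq_0 by simp
    ultimately show ?thesis
      by simp
  qed
  then show ?thesis
    by (subst rfun.dependent_finite) auto
qed

lemma Der_F_subset_span:
  assumes "\<delta> \<in> Der F"
  shows "\<delta> \<in> rfun.span {euler, hamiltonian, vertical}"
proof -
  have \<delta>: "\<delta> \<in> derivations"
    using assms by (simp add: Der_def)
  have "u dvd \<delta> u"
    using Der_F_imp_Der_q[OF assms, of 0] by (simp add: q_0 Der_def)
  then obtain g where g: "\<delta> u = g * u"
    by (metis dvdE mult.commute)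
  define \<delta>' where "\<delta>' = \<delta> - rscale g euler"
  have \<delta>': "\<delta>' \<in> Der F"
    unfolding \<delta>'_def by (intro rfun.subspace_diff rfun.subspace_scale subspace_Der assms basis_Der)
  then have \<delta>'_der: "\<delta>' \<in> derivations"
    by (simp add: Der_def)
  have "\<delta>' u = 0"
    by (simp add: \<delta>'_def rscale_def g)
  \<comment> \<open>This is a syzygy between the partial derivatives of \<open>u\<close>, which are
    constants times powers of different variables. It is therefore a Koszul syzygy, that is, a
    multiple of \<open>hamiltonian\<close>.\<close>
  then have rel: "Const (of_nat r0) * X ^ (r0 - 1) * \<delta>' X + Const (of_nat r1) * Y ^ (r1 - 1) * \<delta>' Y = 0"
    by (simp add: derivation_u[OF \<delta>'_der])
  then have "Const (of_nat r1) * (Y ^ (r1 - 1) * \<delta>' Y) = X ^ (r0 - 1) * (- Const (of_nat r0) * \<delta>' X)"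
    by (simp add: algebra_simps eq_neg_iff_add_eq_0)
  then have "X ^ (r0 - 1) dvd Const (of_nat r1) * (Y ^ (r1 - 1) * \<delta>' Y)"
    by simp
  then have "X ^ (r0 - 1) dvd Y ^ (r1 - 1) * \<delta>' Y"
    using pos by (simp add: dvd_Const_mult_iff)
  then have "X ^ (r0 - 1) dvd \<delta>' Y"
    by (rule X_power_dvd_Y_power_mult)
  then obtain s where s: "\<delta>' Y = X ^ (r0 - 1) * s"
    by (elim dvdE)
  \<comment> \<open>Solves \<open>\<delta>' Y = h * hamiltonian Y\<close>: the sign and the factor
    \<open>r0\<close> come from the y-component of \<open>hamiltonian\<close>.\<close>
  define h where "h = - (Const (1 / of_nat r0) * s)"
  have s_h: "s = - (Const (of_nat r0) * h)"
    using pos by (simp add: h_def flip: mult.assoc Const_mult)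
  have hY: "\<delta>' Y = h * hamiltonian Y"
    by (simp add: s s_h)
  have "Const (of_nat r0) * X ^ (r0 - 1) * (\<delta>' X - h * hamiltonian X) = 0"
    using rel by (simp add: s s_h algebra_simps)
  then have hX: "\<delta>' X = h * hamiltonian X"
    using pos by (simp add: Const_def X_def)
  define \<delta>'' where "\<delta>'' = \<delta>' - rscale h hamiltonian"
  have \<delta>'': "\<delta>'' \<in> Der F"
    unfolding \<delta>''_def by (intro rfun.subspace_diff rfun.subspace_scale subspace_Der \<delta>' basis_Der)
  then have \<delta>''_der: "\<delta>'' \<in> derivations"
    by (simp add: Der_def)
  have XY: "\<delta>'' X = 0" "\<delta>'' Y = 0"
    by (simp_all only: \<delta>''_def rscale_def fun_diff_def hX hY diff_self)
  have "q \<alpha> dvd \<delta>'' Z" if "\<alpha> \<in> \<Lambda>" for \<alpha>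
  proof -
    have "\<alpha> \<noteq> 0"
      using that nonzero by auto
    have "q \<alpha> dvd \<delta>'' (q \<alpha>)"
      using Der_F_imp_Der_q[OF \<delta>'', of \<alpha>] that by (simp add: Der_def)
    \<comment> \<open>With \<open>X\<close> and \<open>Y\<close> killed, only the z-term remains;
      its constants \<open>\<alpha>\<close> and \<open>r2\<close> are units, the latter by
      characteristic 0.\<close>
    also have "\<delta>'' (q \<alpha>) = Const \<alpha> * (Const (of_nat r2) * (Z ^ (r2 - 1) * \<delta>'' Z))"
      by (simp add: derivation_q[OF \<delta>''_der] derivation_u[OF \<delta>''_der] XY mult.assoc)
    finally have "q \<alpha> dvd Z ^ (r2 - 1) * \<delta>'' Z"
      using pos \<open>\<alpha> \<noteq> 0\<close> by (simp add: dvd_Const_mult_iff)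
    then show ?thesis
      by (rule dvd_Z_power_mult_cancel[OF coeff_q_0])
  qed
  then have "P dvd \<delta>'' Z"
    unfolding P_def using finite by (rule prod_q_dvd[rotated])
  then obtain k where k: "\<delta>'' Z = k * P"
    by (metis dvdE mult.commute)
  have "\<delta>'' = rscale k vertical"
  proof (rule derivations_eqI[OF \<delta>''_der])
    show "rscale k vertical \<in> derivations"
      by (intro rfun.subspace_scale subspace_derivations basis_derivations)
  qed (simp_all add: XY k rscale_def)
  then have "\<delta> = rscale g euler + (rscale h hamiltonian + rscale k vertical)"
    by (simp add: \<delta>''_def \<delta>'_def algebra_simps)
  also have "\<dots> \<in> rfun.span {euler, hamiltonian, vertical}"
    by (intro rfun.span_add rfun.span_scale rfun.span_base) simp_all
  finally show ?thesis .
qed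

lemma span_basis: "rfun.span {euler, hamiltonian, vertical} = Der F"
proof
  show "rfun.span {euler, hamiltonian, vertical} \<subseteq> Der F"
    using basis_Der by (intro rfun.span_minimal subspace_Der) simp
  show "Der F \<subseteq> rfun.span {euler, hamiltonian, vertical}"
    by (intro subsetI Der_F_subset_span)
qed

lemma free_divisor_F: "free_divisor F"
  unfolding free_divisor_def free_submodule_def
  by (intro conjI exI[of _ "{euler, hamiltonian, vertical}"] squarefree_F independent_basis span_basis)

end

theorem corollary6p15:
  fixes \<Lambda> :: "'k::field_char_0 set" and r0 r1 r2 :: nat
  assumes "finite \<Lambda>" and "0 \<notin> \<Lambda>"
    and "r0 > 0" and "r1 > 0" and "r2 > 0"
  shows "free_divisor
    ((X ^ r0 + Y ^ r1) * (\<Prod>\<alpha>\<in>\<Lambda>. X ^ r0 + Y ^ r1 + Const \<alpha> * Z ^ r2))"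
proof -
  interpret pencil \<Lambda> r0 r1 r2
    using assms by unfold_locales
  show ?thesis
    using free_divisor_F by (simp add: F_eq P_def q_def u_def)
qed

end
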